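(* $\mathbf{GR}^\bullet$ enjoys Lyndon interpolation property. Moreover, for all $\mathcal{L}_2$-formulas $A$ and $B$, if $\mathbf{GR}^\bullet\vdash A\to B$, then there exists an $\mathcal{L}_2$-formula $C$ with $v^+(C)\subseteq v^+(A)\cap v^+(B)$, $v^-(C)\subseteq v^-(A)\cap v^-(B)$, $\mathbf{GR}^\bullet\vdash A\to C$ and $\mathbf{GR}^\bullet\vdash C\to B$, which additionally satisfies: for each $*\in\{+,-\}$ and each $\mathcal{L}_2$-formula $D$, if $\blacksquare D\in S^*(C)$ then $\blacksquare D\in S^*(A)\cap S^*(B)$.
   Context: $\mathcal{L}_2$ is the bimodal propositional language with countably many propositional variables, $\bot$, connectives $\neg,\vee$ (others defined), and unary modal operators $\Box,\blacksquare$; $\Diamond$ abbreviates $\neg\Box\neg$. The logic $\mathbf{GR}^-$ has as axioms all propositional tautologies of $\mathcal{L}_2$ and all instances of $\Box(A\to B)\to(\Box A\to\Box B)$, $\Box(\Box A\to A)\to\Box A$, $\blacksquare A\to\Box A$, $\Box A\to\Box\blacksquare A$, $\Box A\to(\Box\bot\vee\blacksquare A)$, $\Diamond\blacksquare A\to\Diamond A$, and rules modus ponens and $\Box$-necessitation. $\mathbf{GR}^\circ$ is $\mathbf{GR}^-$ plus the rule: from $A$ infer $\blacksquare A$; $\mathbf{GR}^\bullet$ is $\mathbf{GR}^\circ$ plus the rule: from $\neg A$ infer $\neg\blacksquare A$. Positive and negative subformulas: $S^+(A)=\{A\}$ and $S^-(A)=\emptyset$ if $A$ is a variable or $\bot$;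 $S^+(B\vee C)=S^+(B)\cup S^+(C)\cup\{B\vee C\}$, $S^-(B\vee C)=S^-(B)\cup S^-(C)$; $S^+(\neg B)=S^-(B)\cup\{\neg B\}$, $S^-(\neg B)=S^+(B)$; for $\circledast\in\{\Box,\blacksquare\}$, $S^+(\circledast B)=S^+(B)\cup\{\circledast B\}$, $S^-(\circledast B)=S^-(B)$. $v(A)$ is the set of variables in $A$; $v^*(A)=S^*(A)\cap v(A)$. A logic $L$ has Lyndon interpolation property if whenever $L\vdash A\to B$ there is $C$ with $v^*(C)\subseteq v^*(A)\cap v^*(B)$ for $*\in\{+,-\}$, $L\vdash A\to C$ and $L\vdash C\to B$. *)

theory Defs
  imports Main
begin

datatype fm =
    Var nat
  | Bot
  | Neg fm
  | Or fm fm
  | Box fm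
  | BBox fm  \<comment> \<open>the black box \<open>\<blacksquare>\<close>\<close>

abbreviation Imp :: "fm \<Rightarrow> fm \<Rightarrow> fm" where
  "Imp A B \<equiv> Or (Neg A) B"

abbreviation Dia :: "fm \<Rightarrow> fm" where
  "Dia A \<equiv> Neg (Box (Neg A))"

text \<open>Variables and modal formulas alike count as atoms for propositional tautologies,
  so a valuation assigns truth values to formulas of these shapes.\<close>

primrec peval :: "(fm \<Rightarrow> bool) \<Rightarrow> fm \<Rightarrow> bool" where
  "peval val (Var p) = val (Var p)"
| "peval val Bot = False"
| "peval val (Neg A) = (\<not> peval val A)"
| "peval val (Or A B) = (peval val A \<or> peval val B)"
| "peval val (Box A) = val (Box A)"
| "peval val (BBox A) = val (BBox A)"

definition tautology :: "fm \<Rightarrow> bool" where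
  "tautology A \<longleftrightarrow> (\<forall>val. peval val A)"

inductive_set GR_axioms :: "fm set" where
  taut: "tautology A \<Longrightarrow> A \<in> GR_axioms"
| K: "Imp (Box (Imp A B)) (Imp (Box A) (Box B)) \<in> GR_axioms"
| Loeb: "Imp (Box (Imp (Box A) A)) (Box A) \<in> GR_axioms"
| BBox_Box: "Imp (BBox A) (Box A) \<in> GR_axioms"
| Box_Box_BBox: "Imp (Box A) (Box (BBox A)) \<in> GR_axioms"
| Box_BBox: "Imp (Box A) (Or (Box Bot) (BBox A)) \<in> GR_axioms"
| Dia_BBox: "Imp (Dia (BBox A)) (Dia A) \<in> GR_axioms"

inductive_set GR_minus :: "fm set" where
  axiom: "A \<in> GR_axioms \<Longrightarrow> A \<in> GR_minus"
| mp: "Imp A B \<in> GR_minus \<Longrightarrow> A \<in> GR_minus \<Longrightarrow> B \<in> GR_minus"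
| nec: "A \<in> GR_minus \<Longrightarrow> Box A \<in> GR_minus"

inductive_set GR_circ :: "fm set" where
  axiom: "A \<in> GR_axioms \<Longrightarrow> A \<in> GR_circ"
| mp: "Imp A B \<in> GR_circ \<Longrightarrow> A \<in> GR_circ \<Longrightarrow> B \<in> GR_circ"
| nec: "A \<in> GR_circ \<Longrightarrow> Box A \<in> GR_circ"
| bnec: "A \<in> GR_circ \<Longrightarrow> BBox A \<in> GR_circ"

inductive_set GR_bullet :: "fm set" where
  axiom: "A \<in> GR_axioms \<Longrightarrow> A \<in> GR_bullet"
| mp: "Imp A B \<in> GR_bullet \<Longrightarrow> A \<in> GR_bullet \<Longrightarrow> B \<in> GR_bullet"
| nec: "A \<in> GR_bullet \<Longrightarrow> Box A \<in> GR_bullet"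
| bnec: "A \<in> GR_bullet \<Longrightarrow> BBox A \<in> GR_bullet"
| neg_bnec: "Neg A \<in> GR_bullet \<Longrightarrow> Neg (BBox A) \<in> GR_bullet"

datatype sign = Plus | Minus

text \<open>\<open>signed_subfms Plus A\<close> is \<open>S\<^sup>+(A)\<close> and \<open>signed_subfms Minus A\<close> is \<open>S\<^sup>-(A)\<close>.\<close>

fun signed_subfms :: "sign \<Rightarrow> fm \<Rightarrow> fm set" where
  "signed_subfms Plus (Var p) = {Var p}"
| "signed_subfms Minus (Var p) = {}"
| "signed_subfms Plus Bot = {Bot}"
| "signed_subfms Minus Bot = {}"
| "signed_subfms Plus (Or B C) = signed_subfms Plus B \<union> signed_subfms Plus C \<union> {Or B C}"
| "signed_subfms Minus (Or B C) = signed_subfms Minus B \<union> signed_subfms Minus C"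
| "signed_subfms Plus (Neg B) = signed_subfms Minus B \<union> {Neg B}"
| "signed_subfms Minus (Neg B) = signed_subfms Plus B"
| "signed_subfms Plus (Box B) = signed_subfms Plus B \<union> {Box B}"
| "signed_subfms Minus (Box B) = signed_subfms Minus B"
| "signed_subfms Plus (BBox B) = signed_subfms Plus B \<union> {BBox B}"
| "signed_subfms Minus (BBox B) = signed_subfms Minus B"

primrec vars :: "fm \<Rightarrow> fm set" where
  "vars (Var p) = {Var p}"
| "vars Bot = {}"
| "vars (Neg A) = vars A"
| "vars (Or A B) = vars A \<union> vars B"
| "vars (Box A) = vars A"
| "vars (BBox A) = vars A"

definition signed_vars :: "sign \<Rightarrow> fm \<Rightarrow> fm set" where
  "signed_vars s A = signed_subfms s A \<inter> vars A"

definition lyndon_interpolant :: "fm set \<Rightarrow> fm \<Rightarrow> fm \<Rightarrow> fm \<Rightarrow> bool" where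
  "lyndon_interpolant L A B C \<longleftrightarrow>
     (\<forall>s. signed_vars s C \<subseteq> signed_vars s A \<inter> signed_vars s B) \<and>
     Imp A C \<in> L \<and> Imp C B \<in> L"

definition lyndon_interpolation_property :: "fm set \<Rightarrow> bool" where
  "lyndon_interpolation_property L \<longleftrightarrow>
     (\<forall>A B. Imp A B \<in> L \<longrightarrow> (\<exists>C. lyndon_interpolant L A B C))"

end

theory Submission
  imports Defs
begin

text \<open>
  Suppose that \<open>A \<rightarrow> B\<close> is provable but has no interpolant, and let \<open>F\<close> be the set of formulas
  meeting the syntactic conditions on interpolants.  Consider the pairs \<open>(x, y)\<close> of maximal
  consistent sets with \<open>x \<inter> F \<subseteq> y\<close>; one of them has \<open>A \<in> x\<close> and \<open>B \<notin> y\<close>.  These pairs become a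
  transitive frame when a step is a canonical step in both coordinates which, in at least one
  coordinate, adds a boxed formula \<open>\<box>\<chi>\<close> with \<open>\<chi>\<close> from a fixed finite set.  Such a frame is conversely
  well-founded, and Loeb's axiom still provides all the successors that subformulas of \<open>A\<close> and
  \<open>B\<close> ask for.  In worlds with successors \<open>\<blacksquare>\<close> is read as \<open>\<box>\<close>; in dead ends \<open>\<blacksquare>D\<close> is a fresh atom,
  made as false as \<open>x\<close>, \<open>y\<close> and the axioms permit.  The logic is sound for this model, while
  \<open>A \<rightarrow> B\<close> fails in it.
\<close>

section \<open>Signed subformulas\<close>

fun flip :: "sign \<Rightarrow> sign" where
  "flip Plus = Minus"
| "flip Minus = Plus"

lemma signed_subfms_self: "C \<in> signed_subfms Plus C"
  by (cases C) auto

text \<open>Signs compose: below a positive occurrence they are kept, below a negative one they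
  flip. \<open>Neg\<close> swaps the two situations, so both are proved at once.\<close>

lemma signed_subfms_trans:
  "(E \<in> signed_subfms Plus A \<longrightarrow> signed_subfms s E \<subseteq> signed_subfms s A) \<and>
   (E \<in> signed_subfms Minus A \<longrightarrow> signed_subfms s E \<subseteq> signed_subfms (flip s) A)"
proof (induction A arbitrary: s)
  case (Neg A)
  show ?case
    by (cases s) (use Neg.IH[of Plus] Neg.IH[of Minus] in auto)
next
  case (Or A1 A2)
  show ?case
    by (cases s) (use Or.IH(1)[of Plus] Or.IH(1)[of Minus] Or.IH(2)[of Plus] Or.IH(2)[of Minus] in auto)
next
  case (Box A)
  show ?case
    by (cases s) (use Box.IH[of Plus] Box.IH[of Minus] in auto)
next
  case (BBox A)
  show ?case
    by (cases s) (use BBox.IH[of Plus] BBox.IH[of Minus] in auto)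
qed auto

lemma signed_subfms_NegD: "Neg D \<in> signed_subfms s A \<Longrightarrow> D \<in> signed_subfms (flip s) A"
  using signed_subfms_trans[of "Neg D" A Minus] signed_subfms_self[of D]
  by (cases s) auto

lemma signed_subfms_OrD:
  assumes "Or C D \<in> signed_subfms s A"
  shows "C \<in> signed_subfms s A" "D \<in> signed_subfms s A"
  using assms signed_subfms_trans[of "Or C D" A Plus] signed_subfms_self[of C] signed_subfms_self[of D]
  by (cases s; auto)+

lemma signed_subfms_BoxD: "Box D \<in> signed_subfms s A \<Longrightarrow> D \<in> signed_subfms s A"
  using signed_subfms_trans[of "Box D" A Plus] signed_subfms_self[of D]
  by (cases s) auto

lemma signed_subfms_BBoxD: "BBox D \<in> signed_subfms s A \<Longrightarrow> D \<in> signed_subfms s A"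
  using signed_subfms_trans[of "BBox D" A Plus] signed_subfms_self[of D]
  by (cases s) auto

lemma finite_signed_subfms: "finite (signed_subfms s A)"
  by (induction s A rule: signed_subfms.induct) auto

lemma Var_signed_subfms_vars: "Var p \<in> signed_subfms s A \<Longrightarrow> Var p \<in> vars A"
  by (induction s A rule: signed_subfms.induct) auto

lemma vars_Var: "X \<in> vars A \<Longrightarrow> \<exists>p. X = Var p"
  by (induction A) auto

section \<open>Maximal consistent sets\<close>

text \<open>Local consequence: necessitation is confined to theorems and never touches hypotheses,
  so the deduction theorem holds.\<close>

inductive_set derived :: "fm set \<Rightarrow> fm set" for \<Gamma> where
  hyp: "C \<in> \<Gamma> \<Longrightarrow> C \<in> derived \<Gamma>"
| theorem_of: "C \<in> GR_bullet \<Longrightarrow> C \<in> derived \<Gamma>"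
| mp: "Imp C D \<in> derived \<Gamma> \<Longrightarrow> C \<in> derived \<Gamma> \<Longrightarrow> D \<in> derived \<Gamma>"

lemma GR_bullet_taut: "(\<And>val. peval val C) \<Longrightarrow> C \<in> GR_bullet"
  by (intro GR_bullet.axiom GR_axioms.taut) (simp add: tautology_def)

lemma derived_taut: "(\<And>val. peval val C) \<Longrightarrow> C \<in> derived \<Gamma>"
  by (intro derived.theorem_of GR_bullet_taut)

lemma derived_taut1:
  assumes "C \<in> derived \<Gamma>" "\<And>val. peval val C \<Longrightarrow> peval val D"
  shows "D \<in> derived \<Gamma>"
proof (rule derived.mp[OF _ assms(1)])
  show "Imp C D \<in> derived \<Gamma>"
    by (rule derived_taut) (use assms(2) in auto)
qed

lemma derived_taut2:
  assumes "C \<in> derived \<Gamma>" "D \<in> derived \<Gamma>"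
    "\<And>val. peval val C \<Longrightarrow> peval val D \<Longrightarrow> peval val E"
  shows "E \<in> derived \<Gamma>"
proof (rule derived.mp[OF _ assms(2)])
  show "Imp D E \<in> derived \<Gamma>"
    by (rule derived_taut1[OF assms(1)]) (use assms(3) in auto)
qed

text \<open>A deduction theorem for a whole set: the finitely many members of \<open>G\<close> used
  in a derivation collapse, by directedness, to a single one. This is how one admissible formula is
  extracted from an inconsistency later on.\<close>

lemma derived_directed:
  assumes "E \<in> derived (\<Gamma> \<union> G)" "G \<noteq> {}"
    and dir: "\<And>C D. C \<in> G \<Longrightarrow> D \<in> G \<Longrightarrow> \<exists>H\<in>G. Imp H C \<in> GR_bullet \<and> Imp H D \<in> GR_bullet"
  shows "\<exists>C\<in>G. Imp C E \<in> derived \<Gamma>"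
  using assms(1)
proof (induction rule: derived.induct)
  case (hyp E)
  show ?case
  proof (cases "E \<in> G")
    case True
    then show ?thesis by (meson derived_taut peval.simps(3,4))
  next
    case False
    with hyp have "E \<in> derived \<Gamma>" by (auto intro: derived.hyp)
    then have "Imp C E \<in> derived \<Gamma>" for C by (rule derived_taut1) auto
    with assms(2) show ?thesis by blast
  qed
next
  case (theorem_of E)
  then have "E \<in> derived \<Gamma>" by (rule derived.theorem_of)
  then have "Imp C E \<in> derived \<Gamma>" for C by (rule derived_taut1) auto
  with assms(2) show ?case by blast
next
  case (mp D E)
  then obtain C1 C2 where C: "C1 \<in> G" "C2 \<in> G" "Imp C1 (Imp D E) \<in> derived \<Gamma>" "Imp C2 D \<in> derived \<Gamma>"
    by blast
  then obtain H where H: "H \<in> G" "Imp H C1 \<in> derived \<Gamma>" "Imp H C2 \<in> derived \<Gamma>"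
    using dir derived.theorem_of by meson
  have "Imp H (Imp D E) \<in> derived \<Gamma>" by (rule derived_taut2[OF C(3) H(2)]) auto
  moreover have "Imp H D \<in> derived \<Gamma>" by (rule derived_taut2[OF C(4) H(3)]) auto
  ultimately have "Imp H E \<in> derived \<Gamma>" by (rule derived_taut2) auto
  with H(1) show ?case by blast
qed

lemma derived_insert: "E \<in> derived (insert C \<Gamma>) \<Longrightarrow> Imp C E \<in> derived \<Gamma>"
  using derived_directed[of E \<Gamma> "{C}"] GR_bullet_taut[of "Imp C C"] by auto

lemma derived_empty: "C \<in> derived {} \<Longrightarrow> C \<in> GR_bullet"
  by (induction rule: derived.induct) (auto intro: GR_bullet.mp)

lemma derived_mono: "C \<in> derived \<Gamma> \<Longrightarrow> \<Gamma> \<subseteq> \<Delta> \<Longrightarrow> C \<in> derived \<Delta>"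
  by (induction rule: derived.induct) (auto intro: derived.intros)

lemma derived_Union_chain:
  assumes "C \<in> derived (\<Union>Z)" "Z \<noteq> {}" and chain: "\<And>X Y. X \<in> Z \<Longrightarrow> Y \<in> Z \<Longrightarrow> X \<subseteq> Y \<or> Y \<subseteq> X"
  shows "\<exists>X\<in>Z. C \<in> derived X"
  using assms(1)
proof (induction rule: derived.induct)
  case (mp C D)
  then obtain X Y where "X \<in> Z" "Y \<in> Z" "Imp C D \<in> derived X" "C \<in> derived Y" by blast
  with chain[of X Y] show ?case by (meson derived.mp derived_mono)
qed (use assms(2) in \<open>auto intro: derived.intros\<close>)

definition mcs :: "fm set \<Rightarrow> bool" where
  "mcs x \<longleftrightarrow> derived x \<subseteq> x \<and> (\<forall>C. Neg C \<in> x \<longleftrightarrow> C \<notin> x)"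

lemma Lindenbaum:
  assumes "E \<notin> derived \<Gamma>"
  shows "\<exists>x. mcs x \<and> \<Gamma> \<subseteq> x \<and> E \<notin> x"
proof -
  let ?P = "{\<Delta>. \<Gamma> \<subseteq> \<Delta> \<and> E \<notin> derived \<Delta>}"
  have "\<exists>M\<in>?P. \<forall>X\<in>?P. M \<subseteq> X \<longrightarrow> X = M"
  proof (rule subset_Zorn_nonempty)
    show "?P \<noteq> {}" using assms by blast
    fix Z assume Z: "Z \<noteq> {}" "subset.chain ?P Z"
    then have "E \<notin> derived (\<Union>Z)"
      using derived_Union_chain[of E Z] by (fastforce simp: subset_chain_def)
    moreover have "\<Gamma> \<subseteq> \<Union>Z" using Z unfolding subset_chain_def by blast
    ultimately show "\<Union>Z \<in> ?P" by blast
  qed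
  then obtain x where "x \<in> ?P" and max: "\<forall>X\<in>?P. x \<subseteq> X \<longrightarrow> X = x"
    by (rule bexE)
  then have x: "\<Gamma> \<subseteq> x" "E \<notin> derived x" by auto
  \<comment> \<open>By maximality every formula outside \<open>x\<close> would yield
    \<open>E\<close>; both closure and negation completeness follow from this.\<close>
  have step: "Imp C E \<in> derived x" if "C \<notin> x" for C
  proof (rule derived_insert, rule ccontr)
    assume "E \<notin> derived (insert C x)"
    with x(1) have "insert C x = x" using max by blast
    with that show False by blast
  qed
  have closed: "derived x \<subseteq> x"
    using step x(2) by (meson derived.mp subsetI)
  have "Neg C \<in> x \<longleftrightarrow> C \<notin> x" for C
  proof
    assume "Neg C \<in> x"
    then have "Neg C \<in> derived x" by (rule derived.hyp)
    show "C \<notin> x"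
    proof
      assume "C \<in> x"
      then have "C \<in> derived x" by (rule derived.hyp)
      from derived_taut2[OF this \<open>Neg C \<in> derived x\<close>, of E] x(2) show False by auto
    qed
  next
    assume "C \<notin> x"
    show "Neg C \<in> x"
    proof (rule ccontr)
      assume "Neg C \<notin> x"
      from derived_taut2[OF step[OF \<open>C \<notin> x\<close>] step[OF this], of E] x(2) show False by auto
    qed
  qed
  with closed x show ?thesis
    unfolding mcs_def by (blast intro: derived.hyp)
qed

section \<open>Membership laws for maximal consistent sets\<close>

lemma mcs_Neg [simp]: "mcs x \<Longrightarrow> Neg C \<in> x \<longleftrightarrow> C \<notin> x"
  by (simp add: mcs_def)

lemma mcs_thm: "mcs x \<Longrightarrow> C \<in> GR_bullet \<Longrightarrow> C \<in> x"
  by (auto simp: mcs_def intro: derived.theorem_of)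

lemma mcs_axiom: "mcs x \<Longrightarrow> C \<in> GR_axioms \<Longrightarrow> C \<in> x"
  by (auto intro: mcs_thm GR_bullet.axiom)

lemma mcs_Bot [simp]: "mcs x \<Longrightarrow> Bot \<notin> x"
  using mcs_thm[of x "Neg Bot"] GR_bullet_taut[of "Neg Bot"] by auto

lemma mcs_Or [simp]:
  assumes "mcs x"
  shows "Or C D \<in> x \<longleftrightarrow> C \<in> x \<or> D \<in> x"
proof -
  have cl: "E \<in> x" if "E \<in> derived x" for E using assms that by (auto simp: mcs_def)
  have "Or C D \<in> x" if "C \<in> x \<or> D \<in> x"
    using that
  proof
    assume "C \<in> x"
    then show ?thesis by (rule cl[OF derived_taut1[OF derived.hyp[of C]]]) auto
  next
    assume "D \<in> x"
    then show ?thesis by (rule cl[OF derived_taut1[OF derived.hyp[of D]]]) auto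
  qed
  moreover have "D \<in> x" if "Or C D \<in> x" "C \<notin> x"
    by (rule cl, rule derived_taut2[of "Or C D" _ "Neg C"]) (use that assms in \<open>auto intro: derived.hyp\<close>)
  ultimately show ?thesis by blast
qed

lemma mcs_K: "mcs x \<Longrightarrow> Box (Imp C D) \<in> x \<Longrightarrow> Box C \<in> x \<Longrightarrow> Box D \<in> x"
  using mcs_axiom[OF _ GR_axioms.K[of C D]] by auto

lemma mcs_nec: "mcs x \<Longrightarrow> C \<in> GR_bullet \<Longrightarrow> Box C \<in> x"
  by (auto intro: mcs_thm GR_bullet.nec)

lemma mcs_BBox_Box: "mcs x \<Longrightarrow> BBox C \<in> x \<Longrightarrow> Box C \<in> x"
  using mcs_axiom[OF _ GR_axioms.BBox_Box[of C]] by auto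

lemma mcs_Box_Box_BBox: "mcs x \<Longrightarrow> Box C \<in> x \<Longrightarrow> Box (BBox C) \<in> x"
  using mcs_axiom[OF _ GR_axioms.Box_Box_BBox[of C]] by auto

text \<open>\<open>Box C\<close> gives \<open>Box (BBox C)\<close>, and the boxed theorem from
  \<open>BBox C\<close> to \<open>Box C\<close> turns this into \<open>Box (Box C)\<close>.\<close>

lemma mcs_Box_Box: "mcs x \<Longrightarrow> Box C \<in> x \<Longrightarrow> Box (Box C) \<in> x"
  by (meson GR_axioms.BBox_Box GR_bullet.axiom mcs_Box_Box_BBox mcs_K mcs_nec)

section \<open>Canonical accessibility\<close>

text \<open>Asking for \<open>Box C\<close> at the successor as well makes the relation transitive
  outright.\<close>

definition acc :: "fm set \<Rightarrow> fm set \<Rightarrow> bool" where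
  "acc x x' \<longleftrightarrow> (\<forall>C. Box C \<in> x \<longrightarrow> C \<in> x' \<and> Box C \<in> x')"

definition unboxed :: "fm set \<Rightarrow> fm set" where
  "unboxed x = {C. Box C \<in> x} \<union> {Box C |C. Box C \<in> x}"

lemma acc_iff_unboxed: "acc x x' \<longleftrightarrow> unboxed x \<subseteq> x'"
  by (auto simp: acc_def unboxed_def)

lemma acc_trans: "acc x y \<Longrightarrow> acc y z \<Longrightarrow> acc x z"
  by (simp add: acc_def)

text \<open>A derivation can be boxed line by line: hypotheses by \<open>mcs_Box_Box\<close> where
  needed, theorems by necessitation, modus ponens by K.\<close>

lemma Box_derived_unboxed:
  assumes "mcs x" "C \<in> derived (unboxed x)"
  shows "Box C \<in> x"
  using assms(2)
proof (induction rule: derived.induct)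
  case (hyp C)
  then show ?case using assms(1) by (auto simp: unboxed_def intro: mcs_Box_Box)
qed (use assms(1) in \<open>auto intro: mcs_nec mcs_K\<close>)

text \<open>Loeb's axiom allows a counterexample to \<open>C\<close> that already contains
  \<open>Box C\<close>; this gained box is what makes steps strict later.\<close>

lemma Loeb_successor:
  assumes x: "mcs x" and "Box C \<notin> x"
  shows "\<exists>x'. mcs x' \<and> acc x x' \<and> C \<notin> x' \<and> Box C \<in> x'"
proof -
  have "C \<notin> derived (insert (Box C) (unboxed x))"
  proof
    assume "C \<in> derived (insert (Box C) (unboxed x))"
    then have "Box (Imp (Box C) C) \<in> x"
      by (intro Box_derived_unboxed[OF x] derived_insert)
    with assms mcs_axiom[OF x GR_axioms.Loeb[of C]] show False by auto
  qed
  from Lindenbaum[OF this] show ?thesis by (auto simp: acc_iff_unboxed)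
qed

section \<open>Models\<close>

text \<open>\<open>T w D\<close> and \<open>U w D\<close> say that \<open>D\<close> is required to be true, respectively false, at \<open>w\<close>.\<close>

locale signed_structure =
  fixes R :: "'w \<Rightarrow> 'w \<Rightarrow> bool"
    and T U :: "'w \<Rightarrow> fm \<Rightarrow> bool"
  assumes trans: "R u v \<Longrightarrow> R v w \<Longrightarrow> R u w"
    and conv_wf: "wfp (\<lambda>v u. R u v)"
    and consistent: "D \<in> GR_bullet \<Longrightarrow> Neg D \<notin> GR_bullet"
    and T_U_Var: "T w (Var p) \<Longrightarrow> \<not> U w (Var p)"
    and T_U_BBox: "T w (BBox D) \<Longrightarrow> \<not> U w (BBox D)"
    and T_Bot: "\<not> T w Bot"
    and T_Neg: "T w (Neg D) \<Longrightarrow> U w D"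
    and U_Neg: "U w (Neg D) \<Longrightarrow> T w D"
    and T_Or: "T w (Or C D) \<Longrightarrow> T w C \<or> T w D"
    and U_Or: "U w (Or C D) \<Longrightarrow> U w C \<and> U w D"
    and T_Box: "T w (Box D) \<Longrightarrow> R w v \<Longrightarrow> T v D"
    and U_Box: "U w (Box D) \<Longrightarrow> \<exists>v. R w v \<and> U v D"
    and T_BBox: "T w (BBox D) \<Longrightarrow> R w v \<Longrightarrow> T v D"
    and U_BBox: "U w (BBox D) \<Longrightarrow> R w u \<Longrightarrow> \<exists>v. R w v \<and> U v D"
    and T_BBox_pred: "T w (BBox D) \<Longrightarrow> R u w \<Longrightarrow> \<exists>v. R u v \<and> T v D"
    and U_BBox_pred: "U w (BBox D) \<Longrightarrow> R u w \<Longrightarrow> \<exists>v. R u v \<and> U v D"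
    and T_BBox_thm: "T w (BBox D) \<Longrightarrow> Neg D \<notin> GR_bullet"
    and U_BBox_thm: "U w (BBox D) \<Longrightarrow> D \<notin> GR_bullet"
begin

text \<open>In a dead end \<open>\<blacksquare>D\<close> must hold if a predecessor satisfies \<open>\<box>D\<close>; an isolated point is not constrained by the
  axioms but still by the rules for \<open>\<blacksquare>\<close>.\<close>

primrec sat :: "fm \<Rightarrow> 'w \<Rightarrow> bool" where
  "sat (Var p) w = T w (Var p)"
| "sat Bot w = False"
| "sat (Neg D) w = (\<not> sat D w)"
| "sat (Or C D) w = (sat C w \<or> sat D w)"
| "sat (Box D) w = (\<forall>v. R w v \<longrightarrow> sat D v)"
| "sat (BBox D) w =
     (if \<exists>v. R w v then \<forall>v. R w v \<longrightarrow> sat D v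
      else T w (BBox D) \<or> (\<exists>u. R u w \<and> (\<forall>v. R u v \<longrightarrow> sat D v)) \<or>
           ((\<nexists>u. R u w) \<and> D \<in> GR_bullet))"

text \<open>Both halves go through one induction, since \<open>Neg\<close> exchanges
  \<open>T\<close> and \<open>U\<close>.\<close>

lemma truth: "(T w D \<longrightarrow> sat D w) \<and> (U w D \<longrightarrow> \<not> sat D w)"
proof (induction D arbitrary: w)
  case (Var p)
  then show ?case using T_U_Var by auto
next
  case Bot
  then show ?case using T_Bot by auto
next
  case (Neg D)
  then show ?case using T_Neg U_Neg by auto
next
  case (Or C D)
  then show ?case using T_Or U_Or by (meson sat.simps(4))
next
  case (Box D)
  then show ?case using T_Box U_Box by (meson sat.simps(5))
next
  case (BBox D w)
  show ?case
  proof (cases "\<exists>v. R w v")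
    case True
    have "\<exists>v. R w v \<and> \<not> sat D v" if "U w (BBox D)"
      using that True U_BBox BBox.IH by blast
    moreover have "sat D v" if "T w (BBox D)" "R w v" for v
      using that T_BBox BBox.IH by blast
    ultimately show ?thesis using True by auto
  next
    case False
    \<comment> \<open>In a dead end with \<open>U w (BBox D)\<close> all three clauses of
      \<open>sat\<close> must fail: \<open>T_U_BBox\<close> excludes the first,
      \<open>U_BBox_pred\<close> the second, \<open>U_BBox_thm\<close> the third.\<close>
    have "\<exists>v. R u v \<and> \<not> sat D v" if "U w (BBox D)" "R u w" for u
      using that U_BBox_pred BBox.IH by blast
    with False show ?thesis
      using T_U_BBox[of w D] U_BBox_thm[of w D] by auto
  qed
qed

section \<open>Soundness\<close>

text \<open>Validates \<open>Dia_BBox\<close>. If \<open>w\<close> has a successor, that is also a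
  successor of \<open>u\<close>. In a dead end, the predecessor clause of \<open>sat\<close> makes
  \<open>w\<close> itself the witness, and the \<open>T\<close> clause is covered by
  \<open>T_BBox_pred\<close>.\<close>

lemma sat_BBox_pred:
  assumes "sat (BBox D) w" "R u w"
  shows "\<exists>v. R u v \<and> sat D v"
proof (cases "\<exists>v. R w v")
  case True
  then obtain v where "R w v" "sat D v" using assms(1) by auto
  with assms(2) show ?thesis using trans by blast
next
  case False
  with assms consider "T w (BBox D)" | "sat D w" by auto
  then show ?thesis
    using assms(2) T_BBox_pred truth by cases blast+
qed

text \<open>If \<open>w\<close> has successors this is transitivity; in a dead end \<open>u\<close>
  is the predecessor that \<open>sat\<close> asks for.\<close>

lemma sat_Box_BBox: "sat (Box D) u \<Longrightarrow> R u w \<Longrightarrow> sat (BBox D) w"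
  using trans by auto

lemma sat_Loeb:
  assumes "sat (Box (Imp (Box D) D)) w"
  shows "sat (Box D) w"
proof -
  have "R w v \<longrightarrow> sat D v" for v
  proof (induction v rule: wfp_induct_rule[OF conv_wf])
    case (1 v)
    then show ?case using assms trans by auto
  qed
  then show ?thesis by simp
qed

text \<open>\<open>sat\<close> at a fixed world is a valuation in which modal formulas act as atoms,
  so tautologies are valid.\<close>

lemma peval_sat: "peval (\<lambda>C. sat C w) D \<longleftrightarrow> sat D w"
  by (induction D) auto

lemma sat_axioms: "D \<in> GR_axioms \<Longrightarrow> sat D w"
proof (induction rule: GR_axioms.induct)
  case (taut D)
  then show ?case using peval_sat tautology_def by blast
next
  case (K C D)
  then show ?case by auto
next
  case (Loeb D)
  then show ?case using sat_Loeb by (meson sat.simps(3,4))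
next
  case (BBox_Box D)
  then show ?case by auto
next
  case (Box_Box_BBox D)
  then show ?case using sat_Box_BBox by (meson sat.simps(3,4,5))
next
  case (Box_BBox D)
  then show ?case by auto
next
  case (Dia_BBox D)
  then show ?case using sat_BBox_pred by (metis sat.simps(3,4,5))
qed

lemma soundness: "D \<in> GR_bullet \<Longrightarrow> sat D w"
proof (induction arbitrary: w rule: GR_bullet.induct)
  case (axiom D)
  then show ?case by (rule sat_axioms)
next
  case (mp C D)
  then show ?case by auto
next
  case (nec D)
  then show ?case by auto
next
  \<comment> \<open>The induction hypothesis settles every world that has a successor or a
    predecessor; isolated points rely on the clause \<open>D \<in> GR_bullet\<close> of
    \<open>sat\<close>.\<close>
  case (bnec D)
  then show ?case by auto
next
  case (neg_bnec D w)
  have "\<not> sat (BBox D) w"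
  proof (cases "\<exists>u. R u w")
    case True
    then show ?thesis using sat_BBox_pred neg_bnec.IH by (metis sat.simps(3))
  next
    case False
    \<comment> \<open>Either some successor refutes \<open>D\<close>, or the point is isolated,
      where \<open>T_BBox_thm\<close> and \<open>consistent\<close> exclude the clauses that
      remain.\<close>
    then show ?thesis
      using neg_bnec consistent T_BBox_thm[of w D] by auto
  qed
  then show ?case by simp
qed

end

section \<open>Interpolation\<close>

text \<open>The set \<open>F\<close> of the overview. Boxes are unrestricted, hence closure under
  \<open>Box\<close> and \<open>Dia\<close>. Negation flips signs and may lead out of the set, so
  the link between coordinates is an inclusion in one direction.\<close>

definition admissible :: "fm \<Rightarrow> fm \<Rightarrow> fm set" where
  "admissible A B = {C. \<forall>s. signed_subfms s C \<inter> (range Var \<union> range BBox)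
     \<subseteq> signed_subfms s A \<inter> signed_subfms s B}"

lemma admissible_iff:
  "C \<in> admissible A B \<longleftrightarrow>
    (\<forall>s X. X \<in> signed_subfms s C \<longrightarrow> X \<in> range Var \<union> range BBox \<longrightarrow>
       X \<in> signed_subfms s A \<and> X \<in> signed_subfms s B)"
  unfolding admissible_def by blast

lemma all_sign: "(\<forall>s. P s) \<longleftrightarrow> P Plus \<and> P Minus"
  by (metis sign.exhaust)

lemma admissible_Bot: "Bot \<in> admissible A B"
  by (auto simp: admissible_iff all_sign)

lemma admissible_Top: "Neg Bot \<in> admissible A B"
  by (auto simp: admissible_iff all_sign)

lemma admissible_Or: "C \<in> admissible A B \<Longrightarrow> D \<in> admissible A B \<Longrightarrow> Or C D \<in> admissible A B"
  by (auto simp: admissible_iff all_sign)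

lemma admissible_And:
  "C \<in> admissible A B \<Longrightarrow> D \<in> admissible A B \<Longrightarrow> Neg (Or (Neg C) (Neg D)) \<in> admissible A B"
  by (auto simp: admissible_iff all_sign)

lemma admissible_Box: "C \<in> admissible A B \<Longrightarrow> Box C \<in> admissible A B"
  by (auto simp: admissible_iff all_sign)

lemma admissible_Dia: "C \<in> admissible A B \<Longrightarrow> Dia C \<in> admissible A B"
  by (auto simp: admissible_iff all_sign)

text \<open>Variables and black boxes nested inside \<open>X\<close> carry the right signs too,
  because signs compose.\<close>

lemma admissible_atom:
  assumes "X \<in> range Var \<union> range BBox" "X \<in> signed_subfms Plus A \<inter> signed_subfms Plus B"
  shows "X \<in> admissible A B"
  using assms signed_subfms_trans[of X A] signed_subfms_trans[of X B]
  unfolding admissible_iff by blast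

lemma admissible_neg_atom:
  assumes "X \<in> range Var \<union> range BBox" "X \<in> signed_subfms Minus A \<inter> signed_subfms Minus B"
  shows "Neg X \<in> admissible A B"
  using assms signed_subfms_trans[of X A Plus] signed_subfms_trans[of X A Minus]
    signed_subfms_trans[of X B Plus] signed_subfms_trans[of X B Minus]
  by (auto simp: admissible_iff all_sign)

section \<open>Back and forth between the two coordinates\<close>

text \<open>The admissible formulas outside \<open>y\<close> are closed under disjunction, and a
  negated disjunction implies both negated disjuncts.\<close>

lemma neg_admissible_directed:
  fixes A B y
  defines "G \<equiv> Neg ` (admissible A B - y)"
  assumes "mcs y"
  shows "G \<noteq> {}"
    and "C \<in> G \<Longrightarrow> D \<in> G \<Longrightarrow> \<exists>H\<in>G. Imp H C \<in> GR_bullet \<and> Imp H D \<in> GR_bullet"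
proof -
  show "G \<noteq> {}" unfolding G_def using admissible_Bot assms(2) mcs_Bot by blast
  assume "C \<in> G" "D \<in> G"
  then obtain C' D' where
    "C = Neg C'" "D = Neg D'" "C' \<in> admissible A B - y" "D' \<in> admissible A B - y"
    unfolding G_def by blast
  then show "\<exists>H\<in>G. Imp H C \<in> GR_bullet \<and> Imp H D \<in> GR_bullet"
    unfolding G_def using assms(2)
    by (intro bexI[of _ "Neg (Or C' D')"]) (auto intro: GR_bullet_taut admissible_Or)
qed

text \<open>A failure would come from one admissible \<open>C\<close> in \<open>x'\<close> with
  \<open>Box (Neg C)\<close> in \<open>y\<close>. But \<open>Dia C\<close> is admissible and lies in
  \<open>x\<close>, so it transfers to \<open>y\<close>.\<close>

lemma forth_step:
  assumes y: "mcs y" and xy: "mcs x" "x \<inter> admissible A B \<subseteq> y" and x': "mcs x'" "acc x x'"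
  shows "\<exists>y'. mcs y' \<and> acc y y' \<and> x' \<inter> admissible A B \<subseteq> y'"
proof -
  let ?G = "x' \<inter> admissible A B"
  have "Bot \<notin> derived (unboxed y \<union> ?G)"
  proof
    assume "Bot \<in> derived (unboxed y \<union> ?G)"
    moreover have "?G \<noteq> {}" using admissible_Top x'(1) mcs_Neg mcs_Bot by blast
    moreover have "\<exists>H\<in>?G. Imp H C \<in> GR_bullet \<and> Imp H D \<in> GR_bullet" if "C \<in> ?G" "D \<in> ?G" for C D
      using that x' by (intro bexI[of _ "Neg (Or (Neg C) (Neg D))"])
        (auto intro: GR_bullet_taut admissible_And)
    ultimately have "\<exists>C\<in>?G. Imp C Bot \<in> derived (unboxed y)"
      by (rule derived_directed)
    then obtain C where C: "C \<in> ?G" "Imp C Bot \<in> derived (unboxed y)"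
      by blast
    then have "Neg C \<in> derived (unboxed y)" by (auto intro: derived_taut1)
    then have "Dia C \<notin> y" using y by (simp add: Box_derived_unboxed)
    then have "Dia C \<notin> x" using xy C(1) admissible_Dia by blast
    then have "Neg C \<in> x'" using xy x'(2) by (simp add: acc_def)
    with C(1) x'(1) show False by simp
  qed
  from Lindenbaum[OF this] show ?thesis by (auto simp: acc_iff_unboxed)
qed

text \<open>Dual to \<open>forth_step\<close>: a failure gives an admissible \<open>C\<close>
  outside \<open>y'\<close> with \<open>Box C\<close> in \<open>x\<close>, hence in
  \<open>y\<close>.\<close>

lemma back_step:
  assumes x: "mcs x" and xy: "mcs y" "x \<inter> admissible A B \<subseteq> y" and y': "mcs y'" "acc y y'"
  shows "\<exists>x'. mcs x' \<and> acc x x' \<and> x' \<inter> admissible A B \<subseteq> y'"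
proof -
  let ?G = "Neg ` (admissible A B - y')"
  have "Bot \<notin> derived (unboxed x \<union> ?G)"
  proof
    assume "Bot \<in> derived (unboxed x \<union> ?G)"
    then have "\<exists>C\<in>?G. Imp C Bot \<in> derived (unboxed x)"
      by (rule derived_directed) (use neg_admissible_directed y'(1) in \<open>blast+\<close>)
    then obtain C where C: "C \<in> admissible A B - y'" "Imp (Neg C) Bot \<in> derived (unboxed x)"
      by blast
    then have "C \<in> derived (unboxed x)" by (auto intro: derived_taut1)
    then have "Box C \<in> x" using x by (simp add: Box_derived_unboxed)
    then have "Box C \<in> y" using xy C(1) admissible_Box by blast
    then show False using y'(2) C(1) by (simp add: acc_def)
  qed
  from Lindenbaum[OF this] obtain x' where x': "mcs x'" "unboxed x \<subseteq> x'" "?G \<subseteq> x'" by auto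
  then have "x' \<inter> admissible A B \<subseteq> y'" using mcs_Neg[of x'] by blast
  with x' show ?thesis by (auto simp: acc_iff_unboxed)
qed

lemma inseparable_pair:
  assumes none: "\<And>C. C \<in> admissible A B \<Longrightarrow> Imp A C \<in> GR_bullet \<Longrightarrow> Imp C B \<notin> GR_bullet"
  shows "\<exists>x y. mcs x \<and> mcs y \<and> x \<inter> admissible A B \<subseteq> y \<and> A \<in> x \<and> B \<notin> y"
proof -
  \<comment> \<open>First \<open>y\<close>: it takes in all admissible consequences of
    \<open>A\<close>. If these derived \<open>B\<close>, one of them would be an
    interpolant.\<close>
  let ?G = "{C \<in> admissible A B. Imp A C \<in> GR_bullet}"
  have "B \<notin> derived ({} \<union> ?G)"
  proof
    assume "B \<in> derived ({} \<union> ?G)"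
    moreover have "?G \<noteq> {}" using admissible_Top GR_bullet_taut[of "Imp A (Neg Bot)"] by auto
    moreover have "\<exists>H\<in>?G. Imp H C \<in> GR_bullet \<and> Imp H D \<in> GR_bullet" if "C \<in> ?G" "D \<in> ?G" for C D
    proof (intro bexI[of _ "Neg (Or (Neg C) (Neg D))"])
      have "Imp A (Neg (Or (Neg C) (Neg D))) \<in> derived {}"
        by (rule derived_taut2[of "Imp A C" _ "Imp A D"]) (use that in \<open>auto intro: derived.theorem_of\<close>)
      with that show "Neg (Or (Neg C) (Neg D)) \<in> ?G" by (auto intro: admissible_And derived_empty)
    qed (auto intro: GR_bullet_taut)
    ultimately have "\<exists>C\<in>?G. Imp C B \<in> derived {}"
      by (rule derived_directed)
    then obtain C where "C \<in> ?G" "Imp C B \<in> derived {}"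
      by blast
    then show False using none by (blast dest: derived_empty)
  qed
  from Lindenbaum[OF this] obtain y where y: "mcs y" "?G \<subseteq> y" "B \<notin> y" by auto
  \<comment> \<open>Then \<open>x\<close>: it takes in the negations of the admissible formulas
    outside \<open>y\<close>. If these refuted \<open>A\<close>, one of those formulas would follow
    from \<open>A\<close> and so belong to \<open>y\<close>.\<close>
  let ?N = "Neg ` (admissible A B - y)"
  have "Neg A \<notin> derived ({} \<union> ?N)"
  proof
    assume "Neg A \<in> derived ({} \<union> ?N)"
    then have "\<exists>C\<in>?N. Imp C (Neg A) \<in> derived {}"
      by (rule derived_directed) (use neg_admissible_directed y(1) in \<open>blast+\<close>)
    then obtain C where C: "C \<in> admissible A B - y" "Imp (Neg C) (Neg A) \<in> derived {}"
      by blast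
    then have "Imp A C \<in> derived {}" by (auto intro: derived_taut1)
    with C(1) y(2) show False by (blast dest: derived_empty)
  qed
  from Lindenbaum[OF this] obtain x where x: "mcs x" "?N \<subseteq> x" "A \<in> x" by auto
  then have "x \<inter> admissible A B \<subseteq> y" using mcs_Neg[of x] by blast
  with x y show ?thesis by blast
qed

section \<open>The model of linked pairs\<close>

locale interpolation =
  fixes A B :: fm
begin

definition subs :: "fm set" where
  "subs = (\<Union>s. signed_subfms s A \<union> signed_subfms s B)"

text \<open>Negations are included so that a missing \<open>Box (Neg D)\<close> also produces a
  strict step, as in \<open>verum_successor\<close>.\<close>

definition relevant :: "fm set" where
  "relevant = subs \<union> Neg ` subs"

definition boxes :: "fm set \<Rightarrow> fm set" where
  "boxes x = {C \<in> relevant. Box C \<in> x}"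

definition linked :: "fm set \<times> fm set \<Rightarrow> bool" where
  "linked w \<longleftrightarrow> mcs (fst w) \<and> mcs (snd w) \<and> fst w \<inter> admissible A B \<subseteq> snd w"

definition step :: "fm set \<times> fm set \<Rightarrow> fm set \<times> fm set \<Rightarrow> bool" where
  "step w v \<longleftrightarrow> linked w \<and> linked v \<and> acc (fst w) (fst v) \<and> acc (snd w) (snd v) \<and>
     (boxes (fst w) \<subset> boxes (fst v) \<or> boxes (snd w) \<subset> boxes (snd v))"

text \<open>Refuting \<open>A -> B\<close> means making \<open>A\<close> true and \<open>B\<close>
  false, so \<open>B\<close> enters with reversed signs; \<open>A\<close> is read in the first
  coordinate, \<open>B\<close> in the second.\<close>

definition verum :: "fm set \<times> fm set \<Rightarrow> fm \<Rightarrow> bool" where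
  "verum w D \<longleftrightarrow> linked w \<and>
     (D \<in> signed_subfms Plus A \<and> D \<in> fst w \<or> D \<in> signed_subfms Minus B \<and> D \<in> snd w)"

definition falsum :: "fm set \<times> fm set \<Rightarrow> fm \<Rightarrow> bool" where
  "falsum w D \<longleftrightarrow> linked w \<and>
     (D \<in> signed_subfms Minus A \<and> D \<notin> fst w \<or> D \<in> signed_subfms Plus B \<and> D \<notin> snd w)"

lemma finite_relevant: "finite relevant"
proof -
  have "(UNIV :: sign set) = {Plus, Minus}" by (auto intro: sign.exhaust)
  then have "finite (UNIV :: sign set)" by (metis finite.simps)
  then show ?thesis by (simp add: relevant_def subs_def finite_signed_subfms)
qed

lemma boxes_mono: "acc x x' \<Longrightarrow> boxes x \<subseteq> boxes x'"
  by (auto simp: boxes_def acc_def)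

lemma step_trans:
  assumes "step u v" "step v w"
  shows "step u w"
proof -
  \<comment> \<open>Both coordinates grow weakly, so strict growth in either one survives
    composition.\<close>
  have "boxes (fst v) \<subseteq> boxes (fst w)" "boxes (snd v) \<subseteq> boxes (snd w)"
    "boxes (fst u) \<subseteq> boxes (fst v)" "boxes (snd u) \<subseteq> boxes (snd v)"
    using assms by (auto simp: step_def intro!: boxes_mono)
  with assms show ?thesis unfolding step_def by (meson acc_trans psubset_subset_trans subset_psubset_trans)
qed

text \<open>The count of relevant formulas not yet boxed, summed over both coordinates, drops with
  each step.\<close>

lemma step_conv_wf: "wfp (\<lambda>v u. step u v)"
proof (rule wfp_if_convertible_to_nat)
  let ?m = "\<lambda>w. card (relevant - boxes (fst w)) + card (relevant - boxes (snd w))"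
  fix v u assume st: "step u v"
  have le: "card (relevant - boxes x') \<le> card (relevant - boxes x)" if "acc x x'" for x x'
    using boxes_mono[OF that] finite_relevant by (intro card_mono) auto
  have less: "card (relevant - boxes x') < card (relevant - boxes x)" if "boxes x \<subset> boxes x'" for x x'
    using that finite_relevant by (intro psubset_card_mono) (auto simp: boxes_def)
  show "?m v < ?m u"
    using st le[of "fst u" "fst v"] le[of "snd u" "snd v"] less[of "fst u" "fst v"] less[of "snd u" "snd v"]
    unfolding step_def by linarith
qed

text \<open>\<open>Loeb_successor\<close> moves the first coordinate and gains \<open>Box C\<close>;
  \<open>forth_step\<close> lets the second one follow.\<close>

lemma step_fst:
  assumes w: "linked w" and C: "C \<in> relevant" "Box C \<notin> fst w"
  shows "\<exists>v. step w v \<and> C \<notin> fst v"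
proof -
  obtain x' where x': "mcs x'" "acc (fst w) x'" "C \<notin> x'" "Box C \<in> x'"
    using Loeb_successor[of "fst w" C] w C(2) by (auto simp: linked_def)
  obtain y' where y': "mcs y'" "acc (snd w) y'" "x' \<inter> admissible A B \<subseteq> y'"
    using forth_step[of "snd w" "fst w" A B x'] w x' by (auto simp: linked_def)
  have "boxes (fst w) \<subset> boxes x'" using boxes_mono[OF x'(2)] C x'(4) by (auto simp: boxes_def)
  with w x' y' have "step w (x', y')" by (simp add: step_def linked_def)
  with x'(3) show ?thesis by (metis fst_conv)
qed

lemma step_snd:
  assumes w: "linked w" and C: "C \<in> relevant" "Box C \<notin> snd w"
  shows "\<exists>v. step w v \<and> C \<notin> snd v"
proof -
  obtain y' where y': "mcs y'" "acc (snd w) y'" "C \<notin> y'" "Box C \<in> y'"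
    using Loeb_successor[of "snd w" C] w C(2) by (auto simp: linked_def)
  obtain x' where x': "mcs x'" "acc (fst w) x'" "x' \<inter> admissible A B \<subseteq> y'"
    using back_step[of "fst w" "snd w" A B y'] w y' by (auto simp: linked_def)
  have "boxes (snd w) \<subset> boxes y'" using boxes_mono[OF y'(2)] C y'(4) by (auto simp: boxes_def)
  with w x' y' have "step w (x', y')" by (simp add: step_def linked_def)
  with y'(3) show ?thesis by (metis snd_conv)
qed

lemma relevant_signed:
  assumes "D \<in> signed_subfms s A \<or> D \<in> signed_subfms s B"
  shows "D \<in> relevant" "Neg D \<in> relevant"
  using assms by (auto simp: relevant_def subs_def)

text \<open>A conflict can only arise across the coordinates. If \<open>X\<close> is positive in
  both \<open>A\<close> and \<open>B\<close>, then \<open>X\<close> is admissible and transfers; if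
  negative in both, \<open>Neg X\<close> does.\<close>

lemma verum_falsum_atom:
  assumes "X \<in> range Var \<union> range BBox" "verum w X"
  shows "\<not> falsum w X"
proof
  assume "falsum w X"
  with assms(2) consider
    "X \<in> signed_subfms Plus A \<inter> signed_subfms Plus B" "X \<in> fst w" "X \<notin> snd w"
    | "X \<in> signed_subfms Minus A \<inter> signed_subfms Minus B" "X \<notin> fst w" "X \<in> snd w"
    unfolding verum_def falsum_def by blast
  then show False
  proof cases
    case 1
    then show ?thesis
      using assms(2) admissible_atom[OF assms(1)] unfolding verum_def linked_def by blast
  next
    case 2
    then have "Neg X \<in> fst w" "Neg X \<notin> snd w" using assms(2) by (auto simp: verum_def linked_def)
    then show ?thesis
      using 2(1) assms(2) admissible_neg_atom[OF assms(1)] unfolding verum_def linked_def by blast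
  qed
qed

lemma falsum_successor:
  assumes "linked w" "D \<in> signed_subfms Minus A \<and> Box D \<notin> fst w \<or> D \<in> signed_subfms Plus B \<and> Box D \<notin> snd w"
  shows "\<exists>v. step w v \<and> falsum v D"
  using assms step_fst[OF assms(1), of D] step_snd[OF assms(1), of D] relevant_signed(1)[of D]
  unfolding falsum_def step_def by blast

lemma verum_successor:
  assumes "linked w"
    "D \<in> signed_subfms Plus A \<and> Box (Neg D) \<notin> fst w \<or> D \<in> signed_subfms Minus B \<and> Box (Neg D) \<notin> snd w"
  shows "\<exists>v. step w v \<and> verum v D"
proof -
  have *: "D \<in> fst v \<longleftrightarrow> Neg D \<notin> fst v" "D \<in> snd v \<longleftrightarrow> Neg D \<notin> snd v" "linked v" if "step w v" for v
    using that by (auto simp: step_def linked_def)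
  from assms(2) show ?thesis
  proof
    assume D: "D \<in> signed_subfms Plus A \<and> Box (Neg D) \<notin> fst w"
    then obtain v where "step w v" "Neg D \<notin> fst v"
      using step_fst[OF assms(1)] relevant_signed(2) by blast
    with D *[of v] show ?thesis unfolding verum_def by blast
  next
    assume D: "D \<in> signed_subfms Minus B \<and> Box (Neg D) \<notin> snd w"
    then obtain v where "step w v" "Neg D \<notin> snd v"
      using step_snd[OF assms(1)] relevant_signed(2) by blast
    with D *[of v] show ?thesis unfolding verum_def by blast
  qed
qed

text \<open>Serves \<open>T_BBox_pred\<close>: \<open>BBox D\<close> at \<open>x'\<close> puts
  \<open>Dia (BBox D)\<close> into \<open>x\<close>, and \<open>Dia_BBox\<close> yields
  \<open>Dia D\<close>.\<close>

lemma acc_BBox_Dia: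
  assumes "mcs x" "mcs x'" "acc x x'" "BBox D \<in> x'"
  shows "Box (Neg D) \<notin> x"
proof -
  have "Box (Neg (BBox D)) \<notin> x" using assms mcs_Neg unfolding acc_def by blast
  with mcs_axiom[OF assms(1) GR_axioms.Dia_BBox[of D]] assms(1) show ?thesis by simp
qed

lemma acc_BBox_Box:
  assumes "mcs x" "acc x x'" "BBox D \<notin> x'"
  shows "Box D \<notin> x"
  using assms mcs_Box_Box_BBox unfolding acc_def by blast

text \<open>Having a successor rules out \<open>Box Bot\<close>, the exceptional disjunct of axiom
  \<open>Box_BBox\<close>.\<close>

lemma acc_Box_BBox:
  assumes "mcs x" "mcs x'" "acc x x'" "BBox D \<notin> x"
  shows "Box D \<notin> x"
proof -
  have "Box Bot \<notin> x" using assms mcs_Bot unfolding acc_def by blast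
  with mcs_axiom[OF assms(1) GR_axioms.Box_BBox[of D]] assms(1,4) show ?thesis by simp
qed

lemma signed_structure:
  assumes w0: "linked w0"
  shows "signed_structure step verum falsum"
proof
  fix u v w :: "fm set \<times> fm set" and C D :: fm and p :: nat
  show "step u v \<Longrightarrow> step v w \<Longrightarrow> step u w" by (rule step_trans)
  show "wfp (\<lambda>v u. step u v)" by (rule step_conv_wf)
  \<comment> \<open>The pair \<open>w0\<close> supplies a maximal consistent set, which contains all
    theorems but never both \<open>D\<close> and \<open>Neg D\<close>.\<close>
  show "D \<in> GR_bullet \<Longrightarrow> Neg D \<notin> GR_bullet"
    using w0 mcs_thm mcs_Neg unfolding linked_def by blast
  show "verum w (Var p) \<Longrightarrow> \<not> falsum w (Var p)" "verum w (BBox D) \<Longrightarrow> \<not> falsum w (BBox D)"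
    by (rule verum_falsum_atom; simp)+
  show "\<not> verum w Bot" by (auto simp: verum_def linked_def)
  show "verum w (Neg D) \<Longrightarrow> falsum w D" "falsum w (Neg D) \<Longrightarrow> verum w D"
    by (auto simp: verum_def falsum_def linked_def dest: signed_subfms_NegD)
  show "verum w (Or C D) \<Longrightarrow> verum w C \<or> verum w D" "falsum w (Or C D) \<Longrightarrow> falsum w C \<and> falsum w D"
    by (auto simp: verum_def falsum_def linked_def dest: signed_subfms_OrD)
  show "verum w (Box D) \<Longrightarrow> step w v \<Longrightarrow> verum v D"
    by (auto simp: verum_def step_def acc_def dest: signed_subfms_BoxD)
  show "falsum w (Box D) \<Longrightarrow> \<exists>v. step w v \<and> falsum v D"
    by (rule falsum_successor) (auto simp: falsum_def dest: signed_subfms_BoxD)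
  show "verum w (BBox D) \<Longrightarrow> step w v \<Longrightarrow> verum v D"
    by (auto simp: verum_def step_def acc_def linked_def dest: signed_subfms_BBoxD mcs_BBox_Box)
  show "falsum w (BBox D) \<Longrightarrow> step w u \<Longrightarrow> \<exists>v. step w v \<and> falsum v D"
    by (rule falsum_successor)
      (auto simp: falsum_def step_def linked_def dest: signed_subfms_BBoxD acc_Box_BBox)
  show "verum w (BBox D) \<Longrightarrow> step u w \<Longrightarrow> \<exists>v. step u v \<and> verum v D"
    by (rule verum_successor)
      (auto simp: verum_def step_def linked_def dest: signed_subfms_BBoxD acc_BBox_Dia)
  show "falsum w (BBox D) \<Longrightarrow> step u w \<Longrightarrow> \<exists>v. step u v \<and> falsum v D"
    by (rule falsum_successor)
      (auto simp: falsum_def step_def linked_def dest: signed_subfms_BBoxD acc_BBox_Box)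
  show "Neg D \<notin> GR_bullet" if "verum w (BBox D)"
  proof
    assume "Neg D \<in> GR_bullet"
    then have "Neg (BBox D) \<in> GR_bullet" by (rule GR_bullet.neg_bnec)
    with that show False unfolding verum_def linked_def using mcs_thm mcs_Neg by blast
  qed
  show "falsum w (BBox D) \<Longrightarrow> D \<notin> GR_bullet"
    unfolding falsum_def linked_def using mcs_thm GR_bullet.bnec by blast
qed

end

section \<open>Existence of the interpolant\<close>

lemma admissible_interpolant:
  assumes "Imp A B \<in> GR_bullet"
  shows "\<exists>C\<in>admissible A B. Imp A C \<in> GR_bullet \<and> Imp C B \<in> GR_bullet"
proof (rule ccontr)
  assume "\<not> ?thesis"
  then obtain x y where xy: "mcs x" "mcs y" "x \<inter> admissible A B \<subseteq> y" "A \<in> x" "B \<notin> y"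
    using inseparable_pair[of A B] by blast
  interpret interpolation A B .
  have w: "linked (x, y)" using xy by (simp add: linked_def)
  then interpret signed_structure step verum falsum by (rule signed_structure)
  have "verum (x, y) A" "falsum (x, y) B"
    using w xy by (simp_all add: verum_def falsum_def signed_subfms_self)
  with truth have "\<not> sat (Imp A B) (x, y)" by auto
  with soundness[OF assms] show False by blast
qed

theorem theorem5p4:
  shows "lyndon_interpolation_property GR_bullet \<and>
    (\<forall>A B. Imp A B \<in> GR_bullet \<longrightarrow>
      (\<exists>C. signed_vars Plus C \<subseteq> signed_vars Plus A \<inter> signed_vars Plus B \<and>
           signed_vars Minus C \<subseteq> signed_vars Minus A \<inter> signed_vars Minus B \<and>
           Imp A C \<in> GR_bullet \<and> Imp C B \<in> GR_bullet \<and>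
           (\<forall>s D. BBox D \<in> signed_subfms s C \<longrightarrow>
                  BBox D \<in> signed_subfms s A \<inter> signed_subfms s B)))"
proof -
  \<comment> \<open>Every member of \<open>vars C\<close> is a variable, so admissibility applies to
    it; its signed occurrences in \<open>A\<close> and \<open>B\<close> then also place it in their
    \<open>vars\<close>.\<close>
  have "signed_vars s C \<subseteq> signed_vars s A \<inter> signed_vars s B" if "C \<in> admissible A B" for s A B C
    using that vars_Var Var_signed_subfms_vars unfolding signed_vars_def admissible_iff by blast
  moreover have "BBox D \<in> signed_subfms s A \<inter> signed_subfms s B"
    if "C \<in> admissible A B" "BBox D \<in> signed_subfms s C" for s A B C D
    using that unfolding admissible_iff by blast
  ultimately have "\<exists>C. (\<forall>s. signed_vars s C \<subseteq> signed_vars s A \<inter> signed_vars s B) \<and>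
      Imp A C \<in> GR_bullet \<and> Imp C B \<in> GR_bullet \<and>
      (\<forall>s D. BBox D \<in> signed_subfms s C \<longrightarrow> BBox D \<in> signed_subfms s A \<inter> signed_subfms s B)"
    if "Imp A B \<in> GR_bullet" for A B
    using admissible_interpolant[OF that] by meson
  then show ?thesis
    unfolding lyndon_interpolation_property_def lyndon_interpolant_def by meson
qed

end
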